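(* Let $(P,\preceq)$ be a locally finite lattice and let $f:P\to\mathbb{C}$ be semimultiplicative with $f(x)\neq0$ for all $x\in P$. Let $X=\{x_1,\dots,x_n\}$, $Y=\{y_1,\dots,y_n\}\subseteq P$ be indexed so that $x_i\preceq x_j\Rightarrow i\le j$ and $y_i\preceq y_j\Rightarrow i\le j$, and let $D=\{d_1,\dots,d_m\}$ be any finite subset of $P$ containing all $x_i\vee y_j$, indexed so that $d_i\preceq d_j\Rightarrow i\le j$. Then: (i) if $n>m$, then $\det(X,Y)_f=0$; (ii) if $n\le m$, then $$\det(X,Y)_f=\Big(\prod_{v=1}^n f(x_v)f(y_v)\Big)\sum_{1\le k_1<\cdots<k_n\le m}\det E(X)_{(k_1,\dots,k_n)}\det E(Y)_{(k_1,\dots,k_n)}\,\Psi_{D,1/f}(d_{k_1})\cdots\Psi_{D,1/f}(d_{k_n}).$$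
   Context: $f$ is semimultiplicative if $f(x)f(y)=f(x\wedge y)f(x\vee y)$ for all $x,y\in P$. $(X,Y)_f$ is the $n\times n$ matrix with $(i,j)$ entry $f(x_i\wedge y_j)$. $\Psi_{D,1/f}$ is defined on $D$ recursively by $\Psi_{D,1/f}(d_k)=1/f(d_k)-\sum_{d_v\in D,\ d_k\prec d_v}\Psi_{D,1/f}(d_v)$. $E(X)$ is the $n\times m$ matrix with $(i,j)$ entry $1$ if $x_i\preceq d_j$ and $0$ otherwise; $E(Y)$ likewise with $y_i$. For an $n\times m$ matrix $A$, $A_{(k_1,\dots,k_n)}$ is the $n\times n$ submatrix consisting of columns $k_1<\dots<k_n$. *)

theory Defs
  imports Complex_Main "Jordan_Normal_Form.Determinant"
begin

definition locally_finite :: "'a::order itself \<Rightarrow> bool" where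
  "locally_finite _ \<longleftrightarrow> (\<forall>a b :: 'a. finite {a..b})"

definition semimultiplicative :: "('a::lattice \<Rightarrow> complex) \<Rightarrow> bool" where
  "semimultiplicative f \<longleftrightarrow> (\<forall>x y. f x * f y = f (inf x y) * f (sup x y))"

text \<open>Finite families are functions on \<open>nat\<close>, used only at the indices \<open>0, \<dots>, n - 1\<close>.
  The condition below forces such a family to be injective on these indices, so a family of length
  \<open>n\<close> enumerates a set of exactly \<open>n\<close> elements.\<close>

definition order_indexed :: "nat \<Rightarrow> (nat \<Rightarrow> 'a::order) \<Rightarrow> bool" where
  "order_indexed n x \<longleftrightarrow> (\<forall>i<n. \<forall>j<n. x i \<le> x j \<longrightarrow> i \<le> j)"

definition meet_matrix ::
    "nat \<Rightarrow> (nat \<Rightarrow> 'a::lattice) \<Rightarrow> (nat \<Rightarrow> 'a) \<Rightarrow> ('a \<Rightarrow> complex) \<Rightarrow> complex mat" where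
  "meet_matrix n x y f = mat n n (\<lambda>(i, j). f (inf (x i) (y j)))"

definition incidence_matrix ::
    "nat \<Rightarrow> nat \<Rightarrow> (nat \<Rightarrow> 'a::order) \<Rightarrow> (nat \<Rightarrow> 'a) \<Rightarrow> complex mat" where
  "incidence_matrix n m x d = mat n m (\<lambda>(i, j). if x i \<le> d j then 1 else 0)"

definition select_cols :: "'b mat \<Rightarrow> nat list \<Rightarrow> 'b mat" where
  "select_cols A ks = mat_of_cols (dim_row A) (map (col A) ks)"

definition increasing_tuples :: "nat \<Rightarrow> nat \<Rightarrow> nat list set" where
  "increasing_tuples n m = {ks. length ks = n \<and> sorted_wrt (<) ks \<and> set ks \<subseteq> {..<m}}"

text \<open>The value for infinite \<open>D\<close> is a dummy that makes the recursion total.\<close>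

function Psi :: "'a::order set \<Rightarrow> ('a \<Rightarrow> complex) \<Rightarrow> 'a \<Rightarrow> complex" where
  "Psi D g d = (if finite D then g d - (\<Sum>v \<in> {v \<in> D. d < v}. Psi D g v) else 0)"
  by pat_completeness auto
termination
proof (relation "measure (\<lambda>(D, g, d). card {v \<in> D. d < v})", goal_cases)
  case 1
  show ?case by simp
next
  case (2 D g d v)
  then have "{w \<in> D. v < w} \<subset> {w \<in> D. d < w}"
    by (auto intro: less_trans)
  with 2 show ?case
    by (simp add: psubset_card_mono)
qed

declare Psi.simps [simp del]

lemma Psi_rec:
  "finite D \<Longrightarrow> Psi D g d = g d - (\<Sum>v \<in> {v \<in> D. d < v}. Psi D g v)"
  by (subst Psi.simps) simp

end

theory Submission
  imports Defs
begin

text \<open>Semimultiplicativity gives \<open>f (x \<and> y) = f x * f y / f (x \<or> y)\<close>, and inverting the recursion for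
  \<open>\<Psi>\<close> writes \<open>1 / f (x \<or> y)\<close> as the sum of \<open>\<Psi> d\<close> over all \<open>d \<in> D\<close> above both \<open>x\<close> and \<open>y\<close>. Hence the
  meet matrix is a product of diagonal scalings of \<open>E(X)\<close> and of the transpose of \<open>E(Y)\<close>, and the
  determinant formula is the Cauchy--Binet formula for this product.\<close>

section \<open>The Cauchy--Binet formula\<close>

text \<open>Pigeonhole: \<open>n\<close> distinct indices do not fit below \<open>m\<close>. This
  empties the sum over tuples when \<open>m < n\<close> and so yields case (i).\<close>

lemma increasing_tuples_empty:
  assumes "m < n"
  shows "increasing_tuples n m = {}"
proof -
  have "length ks \<le> m" if "sorted_wrt (<) ks" "set ks \<subseteq> {..<m}" for ks
    using that card_mono[of "{..<m}" "set ks"] by (simp add: strict_sorted_iff distinct_card)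
  then show ?thesis
    using assms by (fastforce simp: increasing_tuples_def)
qed

lemma increasing_tuples_distinct: "ks \<in> increasing_tuples n m \<Longrightarrow> distinct ks"
  by (simp add: increasing_tuples_def strict_sorted_iff)

text \<open>An injective choice function \<open>g\<close> splits uniquely into its image, listed
  increasingly as \<open>ks\<close>, and the permutation \<open>p\<close> for which
  \<open>g i\<close> is entry number \<open>p i\<close> of \<open>ks\<close>. Being the identity
  outside \<open>{0..<n}\<close> makes \<open>g\<close> determined by its values on
  \<open>{0..<n}\<close>; it is also the shape in which the multilinear expansion of the determinant
  delivers its index set.\<close>

lemma bij_betw_increasing_tuples_permutes:
  "bij_betw (\<lambda>(ks, p) i. if i < n then ks ! p i else i)
    (increasing_tuples n m \<times> {p. p permutes {0..<n}})
    {g. (\<forall>i\<in>{0..<n}. g i \<in> {0..<m}) \<and> (\<forall>i. i \<notin> {0..<n} \<longrightarrow> g i = i) \<and> inj_on g {0..<n}}"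
  (is "bij_betw ?h ?S ?G")
proof -
  have image: "?h (ks, p) ` {0..<n} = set ks"
    if "ks \<in> increasing_tuples n m" "p permutes {0..<n}" for ks p
  proof -
    have "?h (ks, p) ` {0..<n} = (!) ks ` (p ` {0..<n})"
      unfolding image_image by (rule image_cong) auto
    also have "\<dots> = set ks"
      using that by (auto simp: permutes_image increasing_tuples_def set_conv_nth)
    finally show ?thesis .
  qed
  have inj: "inj_on ?h ?S"
  proof (rule inj_onI)
    fix a b
    assume "a \<in> ?S" "b \<in> ?S" and eq: "?h a = ?h b"
    then obtain ks p ls q where ab: "a = (ks, p)" "b = (ls, q)"
      and ks: "ks \<in> increasing_tuples n m" and ls: "ls \<in> increasing_tuples n m"
      and p: "p permutes {0..<n}" and q: "q permutes {0..<n}"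
      by (cases a; cases b) auto
    \<comment> \<open>Both tuples list the image of the same function, and a strictly increasing
      list is determined by its set.\<close>
    have "set ks = set ls"
      using image[OF ks p] image[OF ls q] eq unfolding ab by metis
    then have [simp]: "ls = ks"
      using ks ls by (auto simp: increasing_tuples_def intro: strict_sorted_equal)
    have "p i = q i" for i
    proof (cases "i < n")
      case True
      then have "ks ! p i = ks ! q i"
        using fun_cong[OF eq, of i] by (simp add: ab)
      moreover have "p i < n" "q i < n"
        using True permutes_in_image[OF p, of i] permutes_in_image[OF q, of i] by auto
      ultimately show ?thesis
        using ks increasing_tuples_distinct[OF ks]
        by (auto simp: increasing_tuples_def nth_eq_iff_index_eq)
    next
      case False
      then show ?thesis
        using p q by (simp add: permutes_def)
    qed
    then show "a = b"
      by (simp add: ab fun_eq_iff)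
  qed
  have sub: "?h a \<in> ?G" if a_in: "a \<in> ?S" for a
  proof -
    obtain ks p where a: "a = (ks, p)"
      and ks: "ks \<in> increasing_tuples n m" and p: "p permutes {0..<n}"
      using a_in by (cases a) auto
    \<comment> \<open>Injectivity by counting: the image is \<open>set ks\<close>, which has
      \<open>n\<close> elements.\<close>
    have "card (?h (ks, p) ` {0..<n}) = card {0..<n}"
      unfolding image[OF ks p] using ks increasing_tuples_distinct[OF ks]
      by (simp add: distinct_card increasing_tuples_def)
    then have "inj_on (?h (ks, p)) {0..<n}"
      by (intro eq_card_imp_inj_on) auto
    moreover have "?h (ks, p) i \<in> {0..<m}" if "i \<in> {0..<n}" for i
      using imageI[OF that, of "?h (ks, p)"] ks unfolding image[OF ks p]
      by (auto simp: increasing_tuples_def)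
    ultimately show ?thesis
      by (auto simp: a)
  qed
  have sur: "g \<in> ?h ` ?S" if g: "g \<in> ?G" for g
  proof -
    define ks where "ks = sorted_list_of_set (g ` {0..<n})"
    have set_ks: "set ks = g ` {0..<n}"
      by (simp add: ks_def)
    have len: "length ks = n"
      using g by (simp add: ks_def card_image)
    have ks: "ks \<in> increasing_tuples n m"
      using g len set_ks by (auto simp: increasing_tuples_def ks_def)
    have nth: "bij_betw ((!) ks) {0..<n} (g ` {0..<n})"
      using increasing_tuples_distinct[OF ks] len set_ks by (intro bij_betw_nth) auto
    \<comment> \<open>\<open>p i\<close> is the position of \<open>g i\<close> in the sorted list of
      the values of \<open>g\<close>.\<close>
    define p where "p i = (if i < n then inv_into {0..<n} ((!) ks) (g i) else i)" for i
    have "bij_betw (inv_into {0..<n} ((!) ks) \<circ> g) {0..<n} {0..<n}"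
      using g by (intro bij_betw_trans[OF _ bij_betw_inv_into[OF nth]])
        (auto simp: bij_betw_def)
    then have "bij_betw p {0..<n} {0..<n}"
      by (rule bij_betw_cong[THEN iffD1, rotated]) (auto simp: p_def)
    then have p: "p permutes {0..<n}"
      by (rule bij_imp_permutes) (auto simp: p_def)
    have "ks ! p i = g i" if "i < n" for i
      using that bij_betw_inv_into_right[OF nth, of "g i"] by (simp add: p_def)
    then have "?h (ks, p) = g"
      using g by (auto simp: fun_eq_iff)
    then show ?thesis
      using ks p by (intro rev_image_eqI[of "(ks, p)"]) auto
  qed
  show ?thesis
    unfolding bij_betw_def using inj sub sur by blast
qed

lemma select_cols_carrier:
  "A \<in> carrier_mat n m \<Longrightarrow> length ks = k \<Longrightarrow> select_cols A ks \<in> carrier_mat n k"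
  by (auto simp: select_cols_def)

lemma select_cols_index:
  assumes "A \<in> carrier_mat n m" "i < n" "j < length ks" "ks ! j < m"
  shows "select_cols A ks $$ (i, j) = A $$ (i, ks ! j)"
  using assms by (auto simp: select_cols_def mat_of_cols_index)

text \<open>Expand the determinant by multilinearity in the rows, drop the choices that repeat a
  row, and group the others by their image. For a fixed image, the sum over permutations is the
  Leibniz formula for a minor of \<open>A\<close>, times the matching minor of \<open>B\<close>.
  Transposing the second factor lets both minors be selected by columns.\<close>

theorem Cauchy_Binet:
  fixes A B :: "'a::comm_ring_1 mat"
  assumes A: "A \<in> carrier_mat n m" and B: "B \<in> carrier_mat n m"
  shows "det (A * transpose_mat B) =
    (\<Sum>ks\<in>increasing_tuples n m. det (select_cols A ks) * det (select_cols B ks))"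
proof -
  let ?F = "{g. (\<forall>i\<in>{0..<n}. g i \<in> {0..<m}) \<and> (\<forall>i. i \<notin> {0..<n} \<longrightarrow> g i = i)}"
  let ?G = "{g. (\<forall>i\<in>{0..<n}. g i \<in> {0..<m}) \<and> (\<forall>i. i \<notin> {0..<n} \<longrightarrow> g i = i) \<and>
    inj_on g {0..<n}}"
  let ?B = "\<lambda>g. mat\<^sub>r n n (\<lambda>i. row (transpose_mat B) (g i))"
  let ?t = "\<lambda>g. (\<Prod>i=0..<n. A $$ (i, g i)) * det (?B g)"
  let ?P = "{p. p permutes {0..<n}}"
  have BT: "transpose_mat B \<in> carrier_mat m n"
    using B by simp
  have row: "row (transpose_mat B) k \<in> carrier_vec n" for k
    using BT by (auto simp: row_def)
  \<comment> \<open>Row \<open>i\<close> of the product is a linear combination of the rows of the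
    transpose of \<open>B\<close> with coefficients \<open>A $$ (i, k)\<close>. Each
    \<open>g\<close> chooses one summand \<open>k = g i\<close> in every row.\<close>
  have "det (A * transpose_mat B) =
      (\<Sum>g\<in>?F. det (mat\<^sub>r n n (\<lambda>i. A $$ (i, g i) \<cdot>\<^sub>v row (transpose_mat B) (g i))))"
    unfolding mat_mul_finsum_alt[OF A BT] using row
    by (intro det_linear_rows_sum) auto
  also have "\<dots> = (\<Sum>g\<in>?F. ?t g)"
    using row by (intro sum.cong refl det_rows_mul) auto
  also have "\<dots> = (\<Sum>g\<in>?G. ?t g)"
  proof (rule sum.mono_neutral_right)
    show "finite ?F"
      by (rule finite_bounded_functions) auto
    show "\<forall>g\<in>?F - ?G. ?t g = 0"
    proof
      fix g assume "g \<in> ?F - ?G"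
      then obtain i j where ij: "i \<noteq> j" "i < n" "j < n" "g i = g j"
        by (auto simp: inj_on_def)
      have "row (?B g) i = row (?B g) j"
        using ij B by simp
      then have "det (?B g) = 0"
        using ij by (intro det_identical_rows[of "?B g" n i j]) (auto intro: mat_row_carrierI)
      then show "?t g = 0"
        by simp
    qed
  qed auto
  also have "\<dots> = (\<Sum>(ks, p)\<in>increasing_tuples n m \<times> ?P.
      ?t (\<lambda>i. if i < n then ks ! p i else i))"
    by (subst sum.reindex_bij_betw[OF bij_betw_increasing_tuples_permutes, symmetric])
      (simp add: case_prod_unfold)
  also have "\<dots> = (\<Sum>ks\<in>increasing_tuples n m. \<Sum>p\<in>?P.
      ?t (\<lambda>i. if i < n then ks ! p i else i))"
    by (rule sum.cartesian_product[symmetric])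
  also have "\<dots> = (\<Sum>ks\<in>increasing_tuples n m. det (select_cols A ks) * det (select_cols B ks))"
  proof (rule sum.cong[OF refl])
    fix ks assume ks: "ks \<in> increasing_tuples n m"
    have len: "length ks = n" and lt: "\<And>j. j < n \<Longrightarrow> ks ! j < m"
      using ks nth_mem by (auto simp: increasing_tuples_def)
    note car = select_cols_carrier[OF A len] select_cols_carrier[OF B len]
    have "?t (\<lambda>i. if i < n then ks ! p i else i) =
        signof p * (\<Prod>i=0..<n. select_cols A ks $$ (i, p i)) * det (select_cols B ks)"
      if p: "p permutes {0..<n}" for p
    proof -
      have pl: "p i < n" if "i < n" for i
        using permutes_in_image[OF p, of i] that by simp
      \<comment> \<open>The chosen rows are those of the transposed minor of \<open>B\<close>,
        permuted by \<open>p\<close>. The resulting sign is the one that the Leibniz term of the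
        minor of \<open>A\<close> needs.\<close>
      have "?B (\<lambda>i. if i < n then ks ! p i else i) =
          mat n n (\<lambda>(i, j). transpose_mat (select_cols B ks) $$ (p i, j))"
        using B pl lt len car
        by (intro eq_matI) (auto simp: select_cols_index[OF B])
      then have "det (?B (\<lambda>i. if i < n then ks ! p i else i)) =
          signof p * det (select_cols B ks)"
        using det_permute_rows[of "transpose_mat (select_cols B ks)" n p] p car
        by (simp add: det_transpose[OF car(2)])
      moreover have "(\<Prod>i=0..<n. A $$ (i, if i < n then ks ! p i else i)) =
          (\<Prod>i=0..<n. select_cols A ks $$ (i, p i))"
        using pl lt len by (intro prod.cong) (auto simp: select_cols_index[OF A])
      ultimately show ?thesis
        by (simp add: ac_simps)
    qed
    then show "(\<Sum>p\<in>?P. ?t (\<lambda>i. if i < n then ks ! p i else i)) =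
        det (select_cols A ks) * det (select_cols B ks)"
      unfolding det_def'[OF car(1)] sum_distrib_right by (intro sum.cong) auto
  qed
  finally show ?thesis .
qed

text \<open>Each Leibniz term takes one entry from every row and every column, so all terms share
  the same product of scaling factors.\<close>

lemma det_scale_rows_cols:
  fixes C :: "'a::comm_ring_1 mat"
  assumes C: "C \<in> carrier_mat n n"
  shows "det (mat n n (\<lambda>(i, j). a i * b j * C $$ (i, j))) =
    (\<Prod>i<n. a i) * (\<Prod>j<n. b j) * det C"
proof -
  have "(\<Prod>i=0..<n. mat n n (\<lambda>(i, j). a i * b j * C $$ (i, j)) $$ (i, p i)) =
      (\<Prod>i<n. a i) * (\<Prod>j<n. b j) * (\<Prod>i=0..<n. C $$ (i, p i))"
    if p: "p permutes {0..<n}" for p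
  proof -
    have "(\<Prod>i=0..<n. mat n n (\<lambda>(i, j). a i * b j * C $$ (i, j)) $$ (i, p i)) =
        (\<Prod>i=0..<n. a i * b (p i) * C $$ (i, p i))"
      using permutes_in_image[OF p] by (intro prod.cong) auto
    also have "\<dots> = (\<Prod>i=0..<n. a i) * (\<Prod>i=0..<n. b (p i)) * (\<Prod>i=0..<n. C $$ (i, p i))"
      by (simp add: prod.distrib)
    also have "(\<Prod>i=0..<n. b (p i)) = (\<Prod>i=0..<n. b i)"
      using prod.permute[OF p, of b] by (simp add: o_def)
    finally show ?thesis
      by (simp add: atLeast0LessThan)
  qed
  then show ?thesis
    by (simp add: det_def'[OF C] det_def'[of _ n] sum_distrib_left ac_simps)
qed

section \<open>Meet matrices\<close>

text \<open>Moebius inversion from above on \<open>D\<close>: moving the sum in the recursion to the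
  other side adds the terms strictly above \<open>d\<close> to the term at \<open>d\<close>.\<close>

lemma sum_Psi_above:
  assumes "finite D" "d \<in> D"
  shows "(\<Sum>v \<in> {v \<in> D. d \<le> v}. Psi D g v) = g d"
proof -
  have "{v \<in> D. d \<le> v} = insert d {v \<in> D. d < v}"
    using assms by auto
  then show ?thesis
    using assms by (simp add: Psi_rec[of D g d])
qed

lemma order_indexed_inj_on: "order_indexed n x \<Longrightarrow> inj_on x {..<n}"
  by (auto simp: order_indexed_def inj_on_def intro!: antisym)

lemma meet_matrix_factorization:
  assumes f: "semimultiplicative f" "\<forall>z. f z \<noteq> 0"
    and d: "order_indexed m d"
    and D: "\<forall>i<n. \<forall>j<n. sup (x i) (y j) \<in> d ` {..<m}"
  shows "meet_matrix n x y f =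
    mat n m (\<lambda>(i, k). f (x i) * Psi (d ` {..<m}) (\<lambda>z. 1 / f z) (d k) *
      incidence_matrix n m x d $$ (i, k)) *
    transpose_mat (mat n m (\<lambda>(j, k). f (y j) * incidence_matrix n m y d $$ (j, k)))"
    (is "_ = ?A * transpose_mat ?B")
proof (rule eq_matI)
  fix i j
  assume "i < dim_row (?A * transpose_mat ?B)" "j < dim_col (?A * transpose_mat ?B)"
  then have ij: "i < n" "j < n"
    by auto
  let ?P = "Psi (d ` {..<m}) (\<lambda>z. 1 / f z)"
  let ?s = "sup (x i) (y j)"
  have "1 / f ?s = (\<Sum>v \<in> {v \<in> d ` {..<m}. ?s \<le> v}. ?P v)"
    using D ij by (intro sum_Psi_above[symmetric]) auto
  also have "\<dots> = (\<Sum>v \<in> d ` {..<m}. if ?s \<le> v then ?P v else 0)"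
    by (rule sum.inter_filter) simp
  \<comment> \<open>Since \<open>d\<close> enumerates its image without repetition, elements can be
    replaced by indices.\<close>
  also have "\<dots> = (\<Sum>k<m. if ?s \<le> d k then ?P (d k) else 0)"
    using order_indexed_inj_on[OF d] by (simp add: sum.reindex)
  finally have inv: "1 / f ?s = (\<Sum>k<m. if ?s \<le> d k then ?P (d k) else 0)" .
  \<comment> \<open>The two incidence entries multiply to the indicator of
    \<open>?s \<le> d k\<close>, because \<open>d k\<close> lies above both \<open>x i\<close> and
    \<open>y j\<close> exactly when it lies above their join.\<close>
  have "(?A * transpose_mat ?B) $$ (i, j) =
      (\<Sum>k<m. f (x i) * f (y j) * (if ?s \<le> d k then ?P (d k) else 0))"
    using ij by (auto simp: scalar_prod_def incidence_matrix_def atLeast0LessThan intro!: sum.cong)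
  also have "\<dots> = f (x i) * f (y j) * (1 / f ?s)"
    by (simp only: inv sum_distrib_left)
  also have "\<dots> = f (inf (x i) (y j))"
    using f by (auto simp: semimultiplicative_def divide_eq_eq)
  finally show "meet_matrix n x y f $$ (i, j) = (?A * transpose_mat ?B) $$ (i, j)"
    using ij by (simp add: meet_matrix_def)
qed (auto simp: meet_matrix_def)

text \<open>Selecting columns keeps every row factor but only the column factors at the selected
  indices. With \<open>b\<close> taken as \<open>\<Psi>\<close>, these give the product of its
  values along \<open>ks\<close>.\<close>

lemma det_select_cols_scaled:
  fixes E :: "'a::comm_ring_1 mat"
  assumes E: "E \<in> carrier_mat n m" and ks: "ks \<in> increasing_tuples n m"
  shows "det (select_cols (mat n m (\<lambda>(i, k). a i * b k * E $$ (i, k))) ks) =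
    (\<Prod>i<n. a i) * (\<Prod>j<n. b (ks ! j)) * det (select_cols E ks)"
proof -
  have len: "length ks = n" and lt: "\<And>j. j < n \<Longrightarrow> ks ! j < m"
    using ks nth_mem by (auto simp: increasing_tuples_def)
  have M: "mat n m (\<lambda>(i, k). a i * b k * E $$ (i, k)) \<in> carrier_mat n m"
    by simp
  have "select_cols (mat n m (\<lambda>(i, k). a i * b k * E $$ (i, k))) ks =
      mat n n (\<lambda>(i, j). a i * b (ks ! j) * select_cols E ks $$ (i, j))"
    using select_cols_carrier[OF M len] len lt
    by (intro eq_matI) (auto simp: select_cols_index[OF M] select_cols_index[OF E])
  then show ?thesis
    by (simp add: det_scale_rows_cols select_cols_carrier[OF E len])
qed

theorem theorem6p2:
  fixes f :: "'a::lattice \<Rightarrow> complex"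
    and x y d :: "nat \<Rightarrow> 'a"
    and n m :: nat
  assumes "locally_finite TYPE('a)"
    and "semimultiplicative f"
    and "\<forall>z. f z \<noteq> 0"
    and "order_indexed n x"
    and "order_indexed n y"
    and "order_indexed m d"
    and "\<forall>i<n. \<forall>j<n. sup (x i) (y j) \<in> d ` {..<m}"
  shows "(n > m \<longrightarrow> det (meet_matrix n x y f) = 0) \<and>
    (n \<le> m \<longrightarrow> det (meet_matrix n x y f) =
      (\<Prod>v<n. f (x v) * f (y v)) *
      (\<Sum>ks \<in> increasing_tuples n m.
        det (select_cols (incidence_matrix n m x d) ks) *
        det (select_cols (incidence_matrix n m y d) ks) *
        (\<Prod>v<n. Psi (d ` {..<m}) (\<lambda>z. 1 / f z) (d (ks ! v)))))"
proof -
  let ?P = "Psi (d ` {..<m}) (\<lambda>z. 1 / f z)"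
  let ?X = "incidence_matrix n m x d" and ?Y = "incidence_matrix n m y d"
  let ?A = "mat n m (\<lambda>(i, k). f (x i) * ?P (d k) * ?X $$ (i, k))"
  let ?B = "mat n m (\<lambda>(j, k). f (y j) * ?Y $$ (j, k))"
  have X: "?X \<in> carrier_mat n m" and Y: "?Y \<in> carrier_mat n m"
    by (auto simp: incidence_matrix_def)
  \<comment> \<open>This holds for all \<open>n\<close> and \<open>m\<close>; both cases are read
    off from it, (i) because the sum is then empty.\<close>
  have det: "det (meet_matrix n x y f) =
      (\<Sum>ks\<in>increasing_tuples n m. det (select_cols ?A ks) * det (select_cols ?B ks))"
    unfolding meet_matrix_factorization[OF assms(2,3,6,7)] by (rule Cauchy_Binet) auto
  also have "\<dots> = (\<Prod>v<n. f (x v) * f (y v)) * (\<Sum>ks \<in> increasing_tuples n m.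
      det (select_cols ?X ks) * det (select_cols ?Y ks) * (\<Prod>v<n. ?P (d (ks ! v))))"
    unfolding sum_distrib_left
  proof (rule sum.cong[OF refl])
    fix ks assume ks: "ks \<in> increasing_tuples n m"
    have "det (select_cols ?A ks) =
        (\<Prod>i<n. f (x i)) * (\<Prod>j<n. ?P (d (ks ! j))) * det (select_cols ?X ks)"
      by (rule det_select_cols_scaled[OF X ks, of "\<lambda>i. f (x i)" "\<lambda>k. ?P (d k)"])
    moreover have "det (select_cols ?B ks) = (\<Prod>i<n. f (y i)) * det (select_cols ?Y ks)"
      \<comment> \<open>The weights \<open>?P\<close> all sit in \<open>?A\<close>, so the columns
        of \<open>?B\<close> carry the factor 1.\<close>
      using det_select_cols_scaled[OF Y ks, of "\<lambda>i. f (y i)" "\<lambda>_. 1"] by simp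
    ultimately show "det (select_cols ?A ks) * det (select_cols ?B ks) =
        (\<Prod>v<n. f (x v) * f (y v)) *
        (det (select_cols ?X ks) * det (select_cols ?Y ks) * (\<Prod>v<n. ?P (d (ks ! v))))"
      by (simp add: prod.distrib)
  qed
  finally show ?thesis
    using det by (auto simp: increasing_tuples_empty)
qed

end
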